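(* Let $k$ be a positive integer and let $U=\begin{bmatrix} 0 & 1 \\ -2^k & 2^k+1 \end{bmatrix}$. For every positive integer $n$, $$U^n=\begin{bmatrix} -2^kM_{n-1}^{(k)} & M_{n}^{(k)} \\ -2^k M_{n}^{(k)}& M_{n+1}^{(k)} \end{bmatrix}.$$
   Context: The Mersenne numbers $\{M_n\}_{n\ge 0}$ are defined by $M_0=0$, $M_1=1$, $M_{n+2}=3M_{n+1}-2M_n$, i.e. $M_n=2^n-1$. For a positive integer $k$, the higher order Mersenne numbers are $M_n^{(k)}=M_{kn}/M_k$ for $n=0,1,2,\dots$. *)

theory Defs
  imports "Jordan_Normal_Form.Matrix"
begin

fun mersenne :: "nat \<Rightarrow> int" where
  "mersenne 0 = 0"
| "mersenne (Suc 0) = 1"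
| "mersenne (Suc (Suc n)) = 3 * mersenne (Suc n) - 2 * mersenne n"

lemma mersenne_closed_form: "mersenne n = 2 ^ n - 1"
  by (induction n rule: mersenne.induct) auto

(* The quotient is taken in the rationals, so that it is genuine division and
   not truncating integer division. Only k > 0 is meaningful, as M_0 = 0. *)
definition higher_mersenne :: "nat \<Rightarrow> nat \<Rightarrow> rat" where
  "higher_mersenne k n = of_int (mersenne (k * n)) / of_int (mersenne k)"

end

theory Submission
  imports Defs
begin

text \<open>With q = 2^k, the sequence is (q^n - 1) / (q - 1), a combination of the powers of 1 and
  q. These are the roots of x^2 - (q + 1) x + q, whence \<open>higher_mersenne_rec\<close>.
  \<open>U\<close> is the companion matrix of this polynomial, so multiplying by \<open>U\<close> on
  the right advances the index in every entry by one; induction on n finishes.\<close>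

lemma higher_mersenne_closed_form:
  "higher_mersenne k n = ((2 ^ k) ^ n - 1) / (2 ^ k - 1)"
  by (simp add: higher_mersenne_def mersenne_closed_form power_mult)

lemma higher_mersenne_0: "higher_mersenne k 0 = 0"
  by (simp add: higher_mersenne_closed_form)

lemma higher_mersenne_1:
  assumes "k > 0"
  shows "higher_mersenne k (Suc 0) = 1"
proof -
  have "(1 :: rat) < 2 ^ k"
    using assms by (simp add: one_less_power)
  then show ?thesis
    by (simp add: higher_mersenne_closed_form)
qed

lemma higher_mersenne_rec:
  "higher_mersenne k (Suc (Suc n)) =
    (2 ^ k + 1) * higher_mersenne k (Suc n) - 2 ^ k * higher_mersenne k n"
  unfolding higher_mersenne_closed_form times_divide_eq_right diff_divide_distrib [symmetric]
  by (simp add: algebra_simps)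

lemma mat_of_rows_list_2_mult:
  fixes a b c d :: "'a :: semiring_0"
  shows "mat_of_rows_list 2 [[a, b], [c, d]] * mat_of_rows_list 2 [[e, f], [g, h]] =
    mat_of_rows_list 2 [[a * e + b * g, a * f + b * h], [c * e + d * g, c * f + d * h]]"
  by (rule eq_matI)
    (auto simp: mat_of_rows_list_def scalar_prod_def less_Suc_eq numeral_2_eq_2)

theorem theorem3p1:
  fixes k n :: nat and U :: "rat mat"
  assumes "k > 0"
    and "U = mat_of_rows_list 2
      [[0, 1],
       [- (2 ^ k), 2 ^ k + 1]]"
    and "n > 0"
  shows "U ^\<^sub>m n = mat_of_rows_list 2
      [[- (2 ^ k) * higher_mersenne k (n - 1), higher_mersenne k n],
       [- (2 ^ k) * higher_mersenne k n, higher_mersenne k (n + 1)]]"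
  using assms(3)
proof (induction n rule: nat_induct_non_zero)
  case 1
  \<comment> \<open>The first power unfolds to an identity matrix times \<open>U\<close>; the
    dimensions let that factor be absorbed.\<close>
  have "U \<in> carrier_mat 2 2"
    by (simp add: assms(2) mat_of_rows_list_def numeral_2_eq_2)
  then have "U ^\<^sub>m 1 = U"
    by simp
  then show ?case
    using assms(1)
    by (simp add: assms(2) higher_mersenne_0 higher_mersenne_1 higher_mersenne_rec)
next
  case (Suc n)
  \<comment> \<open>Writing n as \<open>Suc m\<close> turns the truncated \<open>n - 1\<close> into
    m, so the recurrence applies to the second column of the product.\<close>
  then obtain m where "n = Suc m"
    using gr0_implies_Suc by blast
  with Suc.IH show ?case
    by (simp add: assms(2) mat_of_rows_list_2_mult higher_mersenne_rec algebra_simps)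
qed

end
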